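(* Let $\eta_\mathrm{V}\in\mathcal{P}(\mathcal{H}_\mathrm{V})$ be a target density operator and $\{\rho(\theta)\}_\theta\subset\mathcal{P}(\mathcal{H}_\mathrm{V}\otimes\mathcal{H}_\mathrm{L})$ a model with $\rho(\theta)$ positive definite for all $\theta$. Fix $\theta^{(t)}$ and let $\eta^{(t)}\in\arg\min\{\mathrm{D_U}(\eta,\rho(\theta^{(t)})) : \eta\in\mathcal{P}(\mathcal{H}_\mathrm{V}\otimes\mathcal{H}_\mathrm{L}),\ \mathrm{Tr}_\mathrm{L}\eta=\eta_\mathrm{V}\}$. Define $\mathcal{Q}(\theta;\theta^{(t)})=\mathrm{Tr}(\eta^{(t)}\log\rho(\theta))+S(\eta^{(t)})-S(\eta_\mathrm{V})$. Suppose $\rho(\theta^{(t)})$ and $\eta^{(t)}$ satisfy $\mathrm{D_U}(\eta^{(t)},\rho(\theta^{(t)}))=\mathrm{D_U}(\eta_\mathrm{V},\mathrm{Tr}_\mathrm{L}\rho(\theta^{(t)}))$ (equivalently, Ruskai's condition). Then $\mathcal{Q}(\cdot;\theta^{(t)})$ is a minorant of $\mathcal{L}$ touching it at $\theta^{(t)}$, i.e. $\mathcal{L}(\theta)\ge\mathcal{Q}(\theta;\theta^{(t)})$ for all $\theta$ and $\mathcal{L}(\theta^{(t)})=\mathcal{Q}(\theta^{(t)};\theta^{(t)})$; consequently, if $\theta^{(t+1)}\in\arg\max_\theta\mathcal{Q}(\theta;\theta^{(t)})$, then $\mathcal{L}(\theta^{(t+1)})\ge\mathcal{L}(\theta^{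(t)})$.
   Context: $\mathcal{P}(\mathcal{H})$ denotes the set of density operators on $\mathcal{H}$; $\mathrm{Tr}_\mathrm{L}$ is the partial trace over $\mathcal{H}_\mathrm{L}$; $S(\eta)=-\mathrm{Tr}(\eta\log\eta)$. $\mathrm{D_U}(\omega,\rho)=\mathrm{Tr}(\omega\log\omega)-\mathrm{Tr}(\omega\log\rho)$ is the Umegaki relative entropy. The log-likelihood is $\mathcal{L}(\theta)=\mathrm{Tr}(\eta_\mathrm{V}\log\mathrm{Tr}_\mathrm{L}\rho(\theta))$. Ruskai's condition for $\omega,\rho\in\mathcal{P}(\mathcal{H}_A\otimes\mathcal{H}_B)$ is $\log\omega-\log\rho=(\log\mathrm{Tr}_B\omega-\log\mathrm{Tr}_B\rho)\otimes\mathrm{I}_B$, which is equivalent to $\mathrm{D_U}(\omega,\rho)=\mathrm{D_U}(\mathrm{Tr}_B\omega,\mathrm{Tr}_B\rho)$. *)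

theory Defs
  imports "Jordan_Normal_Form.Matrix"
begin

text \<open>Finite-dimensional quantum setting. H_V = C^dV, H_L = C^dL, and
  H_V (x) H_L = C^(dV*dL) with the Kronecker index convention
  (a, k) \<mapsto> a * dL + k.  Operators are complex square matrices.\<close>

definition mtrace :: "complex mat \<Rightarrow> complex" where
  "mtrace A = (\<Sum>i<dim_row A. A $$ (i, i))"

definition adj :: "complex mat \<Rightarrow> complex mat" where
  "adj A = mat (dim_col A) (dim_row A) (\<lambda>(i, j). cnj (A $$ (j, i)))"

definition hermitian :: "nat \<Rightarrow> complex mat \<Rightarrow> bool" where
  "hermitian n A \<longleftrightarrow> A \<in> carrier_mat n n \<and> adj A = A"

definition unitary :: "nat \<Rightarrow> complex mat \<Rightarrow> bool" where
  "unitary n U \<longleftrightarrow> U \<in> carrier_mat n n \<and> U * adj U = 1\<^sub>m n \<and> adj U * U = 1\<^sub>m n"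

definition qform :: "nat \<Rightarrow> complex mat \<Rightarrow> (nat \<Rightarrow> complex) \<Rightarrow> complex" where
  "qform n A v = (\<Sum>i<n. \<Sum>j<n. cnj (v i) * A $$ (i, j) * v j)"

definition pos_semidef :: "nat \<Rightarrow> complex mat \<Rightarrow> bool" where
  "pos_semidef n A \<longleftrightarrow> hermitian n A \<and> (\<forall>v. 0 \<le> Re (qform n A v))"

definition pos_def :: "nat \<Rightarrow> complex mat \<Rightarrow> bool" where
  "pos_def n A \<longleftrightarrow> hermitian n A \<and> (\<forall>v. (\<exists>i<n. v i \<noteq> 0) \<longrightarrow> 0 < Re (qform n A v))"

definition density :: "nat \<Rightarrow> complex mat \<Rightarrow> bool" where
  "density n A \<longleftrightarrow> pos_semidef n A \<and> mtrace A = 1"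

definition diag_real :: "nat \<Rightarrow> (nat \<Rightarrow> real) \<Rightarrow> complex mat" where
  "diag_real n d = mat n n (\<lambda>(i, j). if i = j then complex_of_real (d i) else 0)"

text \<open>Functional calculus for Hermitian matrices: f(A) = U diag(f(lambda_i)) U^*
  for a spectral decomposition A = U diag(lambda_i) U^* (independent of the choice).\<close>
definition mat_fun :: "nat \<Rightarrow> (real \<Rightarrow> real) \<Rightarrow> complex mat \<Rightarrow> complex mat" where
  "mat_fun n f A = (SOME B. \<exists>U d. unitary n U \<and> A = U * diag_real n d * adj U
                              \<and> B = U * diag_real n (f \<circ> d) * adj U)"

text \<open>Matrix logarithm (Isabelle's ln satisfies ln 0 = 0, giving the usual
  convention 0 log 0 = 0 in Tr(eta log eta)).\<close>
definition mlog :: "nat \<Rightarrow> complex mat \<Rightarrow> complex mat" where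
  "mlog n A = mat_fun n ln A"

definition ptrace_L :: "nat \<Rightarrow> nat \<Rightarrow> complex mat \<Rightarrow> complex mat" where
  "ptrace_L dV dL A = mat dV dV (\<lambda>(a, b). \<Sum>k<dL. A $$ (a * dL + k, b * dL + k))"

definition vn_entropy :: "nat \<Rightarrow> complex mat \<Rightarrow> real" where
  "vn_entropy n \<eta> = - Re (mtrace (\<eta> * mlog n \<eta>))"

definition umegaki :: "nat \<Rightarrow> complex mat \<Rightarrow> complex mat \<Rightarrow> real" where
  "umegaki n \<omega> \<rho> = Re (mtrace (\<omega> * mlog n \<omega>)) - Re (mtrace (\<omega> * mlog n \<rho>))"

definition loglik :: "nat \<Rightarrow> nat \<Rightarrow> complex mat \<Rightarrow> ('p \<Rightarrow> complex mat) \<Rightarrow> 'p \<Rightarrow> real" where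
  "loglik dV dL \<eta>V \<rho> \<theta> = Re (mtrace (\<eta>V * mlog dV (ptrace_L dV dL (\<rho> \<theta>))))"

definition Qfun :: "nat \<Rightarrow> nat \<Rightarrow> complex mat \<Rightarrow> complex mat \<Rightarrow> ('p \<Rightarrow> complex mat) \<Rightarrow> 'p \<Rightarrow> real" where
  "Qfun dV dL \<eta>V \<eta>t \<rho> \<theta> = Re (mtrace (\<eta>t * mlog (dV * dL) (\<rho> \<theta>)))
      + vn_entropy (dV * dL) \<eta>t - vn_entropy dV \<eta>V"

end

(* The gap between the log-likelihood and Q at theta is D(eta_t, rho) - D(eta_V, Tr_L rho), so the
   minorant property is monotonicity of the relative entropy under the partial trace.
   From ln(a/b) = int_0^infty (1/(b + t a) - 1/(a + t a)) a dt one gets D(eta, rho), up to a term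
   depending only on Tr eta, as the integral over t of F_t(eta, rho), where in
   eigenbases with eigenvalues p_i of eta and q_j of rho and overlaps M_ji
     F_t(eta, rho) = sum_ji |M_ji|^2 p_i^2 / (q_j + t p_i)
                   = max_X (2 Re Tr(X* eta) - Tr(X X* rho) - t Tr(X* X eta)).
   Restricting X to Y (x) I turns the functional into the one of the partial traces, so F_t
   decreases under the partial trace. *)

theory Submission
  imports "Jordan_Normal_Form.Spectral_Radius" Defs
begin

section \<open>Adjoints, real diagonal matrices and traces\<close>

lemma adj_carrier [simp]: "A \<in> carrier_mat n m \<Longrightarrow> adj A \<in> carrier_mat m n"
  by (auto simp: adj_def)

lemma dim_adj [simp]: "dim_row (adj A) = dim_col A" "dim_col (adj A) = dim_row A"
  by (auto simp: adj_def)

lemma adj_index [simp]: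
  "i < dim_col A \<Longrightarrow> j < dim_row A \<Longrightarrow> adj A $$ (i, j) = cnj (A $$ (j, i))"
  by (auto simp: adj_def)

lemma adj_adj [simp]: "adj (adj A) = A"
  by (rule eq_matI) auto

lemma adj_mult:
  assumes "A \<in> carrier_mat n m" "B \<in> carrier_mat m k"
  shows "adj (A * B) = adj B * adj A"
  using assms by (intro eq_matI) (auto simp: scalar_prod_def mult.commute intro!: sum.cong)

lemma diag_real_carrier [simp]: "diag_real n d \<in> carrier_mat n n"
  by (auto simp: diag_real_def)

lemma dim_diag_real [simp]: "dim_row (diag_real n d) = n" "dim_col (diag_real n d) = n"
  by (auto simp: diag_real_def)

lemma index_diag_real [simp]:
  "i < n \<Longrightarrow> j < n \<Longrightarrow> diag_real n d $$ (i, j) = (if i = j then complex_of_real (d i) else 0)"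
  by (auto simp: diag_real_def)

lemma index_mult_sum:
  assumes "A \<in> carrier_mat n m" "B \<in> carrier_mat m k" "i < n" "j < k"
  shows "(A * B) $$ (i, j) = (\<Sum>l<m. A $$ (i, l) * B $$ (l, j))"
  using assms by (auto simp: scalar_prod_def atLeast0LessThan)

lemma index_mult_diag_real [simp]:
  assumes "A \<in> carrier_mat n m" "i < n" "j < m"
  shows "(A * diag_real m d) $$ (i, j) = A $$ (i, j) * complex_of_real (d j)"
proof -
  have "(A * diag_real m d) $$ (i, j)
      = (\<Sum>l<m. A $$ (i, l) * (if l = j then complex_of_real (d l) else 0))"
    using assms by (subst index_mult_sum[of _ n m _ m]) auto
  also have "\<dots> = (\<Sum>l<m. if l = j then A $$ (i, l) * complex_of_real (d l) else 0)"
    by (rule sum.cong) auto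
  finally show ?thesis using assms by simp
qed

lemma diag_real_mult: "diag_real n a * diag_real n b = diag_real n (\<lambda>i. a i * b i)"
  by (rule eq_matI) (auto simp del: index_mult_mat(1) simp: index_mult_diag_real[of _ n])

lemma mtrace_mult:
  assumes "A \<in> carrier_mat n m" "B \<in> carrier_mat m n"
  shows "mtrace (A * B) = (\<Sum>i<n. \<Sum>j<m. A $$ (i, j) * B $$ (j, i))"
  using assms by (auto simp: mtrace_def scalar_prod_def atLeast0LessThan intro!: sum.cong)

lemma mtrace_cyclic:
  assumes "A \<in> carrier_mat n m" "B \<in> carrier_mat m n"
  shows "mtrace (A * B) = mtrace (B * A)"
  unfolding mtrace_mult[OF assms] mtrace_mult[OF assms(2,1)]
  by (subst sum.swap) (simp add: mult.commute)

lemma square_mult_carrier [simp]: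
  "A \<in> carrier_mat n n \<Longrightarrow> B \<in> carrier_mat n n \<Longrightarrow> A * B \<in> carrier_mat n n"
  by (rule mult_carrier_mat)

subsection \<open>The spectral theorem\<close>

lemma unitaryI:
  assumes "U \<in> carrier_mat n n" "adj U * U = 1\<^sub>m n"
  shows "unitary n U"
  using assms mat_mult_left_right_inverse[of "adj U" n U] by (auto simp: unitary_def)

lemma unitary_mult:
  assumes "unitary n U" "unitary n V"
  shows "unitary n (U * V)"
proof (rule unitaryI)
  have c: "U \<in> carrier_mat n n" "V \<in> carrier_mat n n"
    "adj U \<in> carrier_mat n n" "adj V \<in> carrier_mat n n"
    using assms by (auto simp: unitary_def)
  then show "U * V \<in> carrier_mat n n" by simp
  have "adj U * (U * V) = V"
    using assms c by (simp add: unitary_def assoc_mult_mat[of _ n n _ n _ n, symmetric])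
  then show "adj (U * V) * (U * V) = 1\<^sub>m n"
    using assms c by (simp add: unitary_def adj_mult[OF c(1,2)] assoc_mult_mat[of _ n n _ n _ n])
qed

lemma adj_four_block:
  assumes "A \<in> carrier_mat n n" "B \<in> carrier_mat n m" "C \<in> carrier_mat m n" "D \<in> carrier_mat m m"
  shows "adj (four_block_mat A B C D) = four_block_mat (adj A) (adj C) (adj B) (adj D)"
  using assms by (intro eq_matI) auto

text \<open>Complete \<open>v\<close> to a basis, orthogonalise it and normalise the columns. The
  scalar \<open>c\<close> stays unspecified since only the line spanned by \<open>v\<close>
  matters.\<close>

lemma unitary_first_column:
  assumes v: "v \<in> carrier_vec n" and v0: "v \<noteq> 0\<^sub>v n"
  obtains U c where "unitary n U" "col U 0 = c \<cdot>\<^sub>v v"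
proof -
  interpret cof_vec_space n "TYPE(complex)" .
  define bs where "bs = basis_completion v"
  define ws where "ws = gram_schmidt n bs"
  note b = basis_completion[OF v v0, folded bs_def]
  have n0: "n \<noteq> 0" using v v0 by auto
  obtain bs' where bs': "bs = v # bs'" using b(6,7) n0 by (cases bs) auto
  have ws: "set ws \<subseteq> carrier_vec n" "corthogonal ws" "length ws = n"
    using gram_schmidt_result[OF b(2,4,5) ws_def] b(6) by auto
  \<comment> \<open>Gram-Schmidt leaves the first vector of the list unchanged.\<close>
  have hd: "hd ws = v" unfolding ws_def bs' using v by simp
  have ws0: "ws ! 0 = v" using hd ws(3) n0 by (metis hd_conv_nth list.size(3))
  have wc: "ws ! i \<in> carrier_vec n" if "i < n" for i using ws that by auto
  \<comment> \<open>\<open>gram_schmidt\<close> orthogonalises without normalising, so the columns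
    of \<open>U\<close> are divided by these norms.\<close>
  define r where "r i = sqrt (\<Sum>k<n. (cmod (ws ! i $ k))\<^sup>2)" for i
  have inner: "ws ! j \<bullet>c ws ! i = (\<Sum>k<n. ws ! j $ k * cnj (ws ! i $ k))" if "i < n" "j < n" for i j
    using wc[OF that(1)] wc[OF that(2)] by (auto simp: scalar_prod_def atLeast0LessThan intro!: sum.cong)
  have rr: "ws ! i \<bullet>c ws ! i = complex_of_real (r i ^ 2)" if "i < n" for i
    unfolding inner[OF that that] r_def
    by (subst real_sqrt_pow2) (auto intro!: sum_nonneg simp: complex_norm_square[symmetric] simp del: of_real_power)
  have r0: "r i \<noteq> 0" if "i < n" for i
    using corthogonalD[OF ws(2), of i i] rr[OF that] that ws(3) by auto
  define U where "U = mat n n (\<lambda>(k, i). ws ! i $ k / complex_of_real (r i))"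
  have U: "U \<in> carrier_mat n n" by (simp add: U_def)
  have "adj U * U = 1\<^sub>m n"
  proof (rule eq_matI)
    fix i j assume "i < dim_row (1\<^sub>m n)" "j < dim_col (1\<^sub>m n)"
    then have ij: "i < n" "j < n" by auto
    have "(adj U * U) $$ (i, j) = (\<Sum>k<n. ws ! j $ k * cnj (ws ! i $ k)) / (r i * r j)"
      using ij U by (subst index_mult_sum[of _ n n _ n])
        (auto simp: U_def sum_divide_distrib mult.commute intro!: sum.cong)
    also have "\<dots> = (ws ! j \<bullet>c ws ! i) / (r i * r j)" using inner[OF ij] by simp
    also have "\<dots> = (if i = j then 1 else 0)"
      using corthogonalD[OF ws(2), of j i] rr[OF ij(1)] r0[OF ij(1)] ij ws(3)
      by (auto simp: power2_eq_square)
    finally show "(adj U * U) $$ (i, j) = 1\<^sub>m n $$ (i, j)" using ij by simp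
  qed (use U in auto)
  then have "unitary n U" using U by (intro unitaryI)
  moreover have "col U 0 = (1 / complex_of_real (r 0)) \<cdot>\<^sub>v v"
    using v n0 by (intro eq_vecI) (auto simp: U_def ws0)
  ultimately show ?thesis by (rule that)
qed

lemma hermitian_conj:
  assumes "hermitian n A" "U \<in> carrier_mat n m"
  shows "hermitian m (adj U * A * U)"
proof -
  have c: "A \<in> carrier_mat n n" "adj U \<in> carrier_mat m n" "adj A = A"
    using assms by (auto simp: hermitian_def)
  have "adj (adj U * A * U) = adj U * adj (adj U * A)"
    using c assms by (subst adj_mult[of _ m n _ m]) auto
  also have "\<dots> = adj U * A * U"
    using c assms by (subst adj_mult[of _ m n _ n]) (auto simp: assoc_mult_mat[of _ m n _ n _ m])
  finally show ?thesis using c assms by (auto simp: hermitian_def assoc_mult_mat[of _ m n _ n _ m])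
qed

text \<open>Induction on the dimension. In an orthonormal basis that starts with an eigenvector, the
  matrix splits into a 1 by 1 block and a smaller hermitian block, to which the induction hypothesis
  applies.\<close>

theorem hermitian_diagonalization:
  assumes "hermitian n A"
  shows "\<exists>U d. unitary n U \<and> A = U * diag_real n d * adj U"
  using assms
proof (induction n arbitrary: A)
  case 0
  then have "A \<in> carrier_mat 0 0" by (simp add: hermitian_def)
  then have "unitary 0 (1\<^sub>m 0) \<and> A = 1\<^sub>m 0 * diag_real 0 (\<lambda>_. 0) * adj (1\<^sub>m 0)"
    by (auto simp: unitary_def intro!: eq_matI)
  then show ?case by blast
next
  case (Suc n)
  have A: "A \<in> carrier_mat (Suc n) (Suc n)" using Suc.prems by (simp add: hermitian_def)
  obtain e where "eigenvalue A e"
    using spectrum_non_empty[OF A] by (auto simp: spectrum_def)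
  then obtain v where v: "v \<in> carrier_vec (Suc n)" "v \<noteq> 0\<^sub>v (Suc n)" "A *\<^sub>v v = e \<cdot>\<^sub>v v"
    using A by (auto simp: eigenvalue_def eigenvector_def)
  obtain U c where U: "unitary (Suc n) U" and Uc: "col U 0 = c \<cdot>\<^sub>v v"
    using unitary_first_column[OF v(1,2)] by blast
  have c: "U \<in> carrier_mat (Suc n) (Suc n)" "adj U \<in> carrier_mat (Suc n) (Suc n)"
    and u: "adj U * U = 1\<^sub>m (Suc n)" "U * adj U = 1\<^sub>m (Suc n)"
    using U by (auto simp: unitary_def)
  define B where "B = adj U * A * U"
  have B: "hermitian (Suc n) B" unfolding B_def using Suc.prems c by (intro hermitian_conj)
  have Bc: "B \<in> carrier_mat (Suc n) (Suc n)" using B by (simp add: hermitian_def)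
  have Bsym: "B $$ (i, j) = cnj (B $$ (j, i))" if "i < Suc n" "j < Suc n" for i j
  proof -
    have "B $$ (i, j) = adj B $$ (i, j)" using B by (simp add: hermitian_def)
    then show ?thesis using that Bc by simp
  qed
  \<comment> \<open>The first column of \<open>U\<close> is an eigenvector of \<open>A\<close> for
    \<open>e\<close>, and \<open>adj U\<close> sends it to the first unit vector; hence the first
    column of \<open>B\<close> is \<open>e\<close> times that vector, and hermiticity clears the
    first row as well.\<close>
  have "col B 0 = (adj U * A) *\<^sub>v col U 0"
    unfolding B_def using A c by (intro col_mult2[of _ "Suc n" "Suc n" _ "Suc n"]) auto
  also have "\<dots> = adj U *\<^sub>v (A *\<^sub>v col U 0)"
    using A c by (intro assoc_mult_mat_vec[of _ "Suc n" "Suc n" _ "Suc n"] col_carrier_vec[OF zero_less_Suc]) auto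
  also have "A *\<^sub>v col U 0 = e \<cdot>\<^sub>v col U 0"
    unfolding Uc using A v by (simp add: mult_mat_vec[OF A v(1)] smult_smult_assoc mult.commute)
  also have "adj U *\<^sub>v (e \<cdot>\<^sub>v col U 0) = e \<cdot>\<^sub>v (adj U *\<^sub>v col U 0)"
    by (rule mult_mat_vec[OF c(2) col_carrier_vec[OF zero_less_Suc c(1)]])
  also have "adj U *\<^sub>v col U 0 = col (1\<^sub>m (Suc n)) 0"
    using c unfolding u(1)[symmetric] by (simp add: col_mult2[of _ "Suc n" "Suc n" _ "Suc n"])
  finally have Bcol: "col B 0 = e \<cdot>\<^sub>v col (1\<^sub>m (Suc n)) 0" .
  have B0: "B $$ (i, 0) = (if i = 0 then e else 0)" if "i < Suc n" for i
    using arg_cong[OF Bcol, of "\<lambda>w. w $ i"] that Bc by auto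
  have B0': "B $$ (0, i) = 0" if "0 < i" "i < Suc n" for i
    using Bsym[of 0 i] B0[of i] that by simp
  \<comment> \<open>A diagonal entry of a hermitian matrix equals its own conjugate, so
    \<open>e\<close> is real and fits into \<open>diag_real\<close>.\<close>
  have er: "B $$ (0, 0) = complex_of_real (Re e)"
    using Bsym[of 0 0] B0[of 0] by (simp add: complex_eq_iff)
  define A1 where "A1 = mat n n (\<lambda>(i, j). B $$ (Suc i, Suc j))"
  have "hermitian n A1"
    unfolding hermitian_def
  proof
    show "adj A1 = A1"
      by (rule eq_matI) (auto simp: A1_def Bsym[symmetric])
  qed (simp add: A1_def)
  from Suc.IH[OF this] obtain U1 d where U1: "unitary n U1" and A1: "A1 = U1 * diag_real n d * adj U1"
    by blast
  have U1c: "U1 \<in> carrier_mat n n" "adj U1 \<in> carrier_mat n n" "adj U1 * U1 = 1\<^sub>m n"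
    using U1 by (auto simp: unitary_def)
  \<comment> \<open>\<open>V\<close> is the direct sum of 1 and \<open>U1\<close>; the index shift
    in \<open>d'\<close> puts the eigenvalue \<open>Re e\<close> in front of those of
    \<open>A1\<close>.\<close>
  define V where "V = four_block_mat (1\<^sub>m 1) (0\<^sub>m 1 n) (0\<^sub>m n 1) U1"
  define d' where "d' i = (if i = 0 then Re e else d (i - 1))" for i
  have Vc: "V \<in> carrier_mat (Suc n) (Suc n)" using U1c by (auto simp: V_def)
  have adj1: "adj (1\<^sub>m 1) = 1\<^sub>m 1" "adj (0\<^sub>m 1 n) = 0\<^sub>m n 1" "adj (0\<^sub>m n 1) = 0\<^sub>m 1 n"
    by (auto intro!: eq_matI)
  have adjV: "adj V = four_block_mat (1\<^sub>m 1) (0\<^sub>m 1 n) (0\<^sub>m n 1) (adj U1)"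
    unfolding V_def using U1c by (subst adj_four_block[of _ 1 _ n]) (auto simp: adj1)
  have D: "diag_real (Suc n) d' = four_block_mat (diag_real 1 (\<lambda>_. Re e)) (0\<^sub>m 1 n) (0\<^sub>m n 1) (diag_real n d)"
    by (rule eq_matI) (auto simp: d'_def)
  have one: "1\<^sub>m (Suc n) = four_block_mat (1\<^sub>m 1) (0\<^sub>m 1 n) (0\<^sub>m n 1) (1\<^sub>m n)"
    by (rule eq_matI) auto
  have "adj V * V = 1\<^sub>m (Suc n)"
    unfolding adjV one unfolding V_def using U1c
    by (subst mult_four_block_mat[of _ 1 1 _ n _ n _ _ 1 _ n]) auto
  then have V: "unitary (Suc n) V" using Vc by (intro unitaryI)
  have Bblock: "B = four_block_mat (diag_real 1 (\<lambda>_. Re e)) (0\<^sub>m 1 n) (0\<^sub>m n 1) A1"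
    using Bc by (intro eq_matI) (auto simp: A1_def er B0 B0')
  have "V * diag_real (Suc n) d' * adj V = B"
  proof -
    have "V * diag_real (Suc n) d' = four_block_mat (diag_real 1 (\<lambda>_. Re e)) (0\<^sub>m 1 n) (0\<^sub>m n 1) (U1 * diag_real n d)"
      unfolding D V_def using U1c by (subst mult_four_block_mat[of _ 1 1 _ n _ n _ _ 1 _ n]) auto
    then show ?thesis
      unfolding Bblock adjV A1 using U1c by (simp, subst mult_four_block_mat[of _ 1 1 _ n _ n _ _ 1 _ n]) auto
  qed
  then have "U * (V * diag_real (Suc n) d' * adj V) * adj U = U * (adj U * A * U) * adj U"
    by (simp add: B_def)
  also have "\<dots> = (U * adj U) * A * (U * adj U)"
    using c A by (simp add: assoc_mult_mat[of _ "Suc n" "Suc n" _ "Suc n" _ "Suc n"])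
  also have "\<dots> = A" using u A by simp
  finally have "A = U * (V * diag_real (Suc n) d' * adj V) * adj U" by simp
  also have "\<dots> = (U * V) * diag_real (Suc n) d' * adj (U * V)"
    using c Vc by (simp add: adj_mult[OF c(1) Vc] assoc_mult_mat[of _ "Suc n" "Suc n" _ "Suc n" _ "Suc n"])
  finally show ?case using unitary_mult[OF U V] by blast
qed

section \<open>Functional calculus, signs of eigenvalues and traces in two eigenbases\<close>

text \<open>\<open>someI_ex\<close> returns the decomposition from which the chosen value arises.
  Later proofs work in this very eigenbasis, common to \<open>A\<close> and
  \<open>mat_fun n f A\<close>.\<close>

lemma mat_fun_spectral:
  assumes "hermitian n A"
  shows "\<exists>U d. unitary n U \<and> A = U * diag_real n d * adj U
           \<and> mat_fun n f A = U * diag_real n (f \<circ> d) * adj U"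
  unfolding mat_fun_def by (rule someI_ex) (use hermitian_diagonalization[OF assms] in blast)

lemma unitary_cancel:
  assumes "unitary n U" "B \<in> carrier_mat n m"
  shows "adj U * (U * B) = B" "U * (adj U * B) = B"
  using assms by (auto simp: unitary_def assoc_mult_mat[of _ n n _ n _ m, symmetric])

text \<open>Column \<open>i\<close> of \<open>U\<close> is a unit eigenvector, so the quadratic form
  at it reads off the eigenvalue; this converts definiteness into signs of \<open>d\<close>.\<close>

lemma qform_column:
  assumes "unitary n U" "A = U * diag_real n d * adj U" "i < n"
  shows "qform n A (\<lambda>k. U $$ (k, i)) = complex_of_real (d i)"
proof -
  have c: "U \<in> carrier_mat n n" "adj U \<in> carrier_mat n n" "A \<in> carrier_mat n n"
    using assms by (auto simp: unitary_def)
  have "adj U * (A * U) = diag_real n d"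
    using c assms(1) unfolding assms(2)
    by (simp add: assoc_mult_mat[of _ n n _ n _ n] unitary_cancel[of n _ _ n])
       (simp add: unitary_def)
  then have "complex_of_real (d i) = (adj U * (A * U)) $$ (i, i)" using assms(3) by simp
  also have "\<dots> = (\<Sum>k<n. adj U $$ (i, k) * (\<Sum>l<n. A $$ (k, l) * U $$ (l, i)))"
    using c assms(3) by (subst index_mult_sum[of _ n n _ n])
      (auto simp del: index_mult_mat(1) simp: index_mult_sum[of _ n n _ n])
  also have "\<dots> = qform n A (\<lambda>k. U $$ (k, i))"
    unfolding qform_def using c assms(3)
    by (auto simp: sum_distrib_left mult.assoc intro!: sum.cong)
  finally show ?thesis by simp
qed

lemma pos_semidef_eigenvalue:
  assumes "pos_semidef n A" "unitary n U" "A = U * diag_real n d * adj U" "i < n"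
  shows "0 \<le> d i"
proof -
  have "0 \<le> Re (qform n A (\<lambda>k. U $$ (k, i)))"
    using assms(1) by (simp add: pos_semidef_def)
  then show ?thesis using qform_column[OF assms(2-4)] by simp
qed

lemma pos_def_eigenvalue:
  assumes "pos_def n A" "unitary n U" "A = U * diag_real n d * adj U" "i < n"
  shows "0 < d i"
proof -
  have U: "U \<in> carrier_mat n n" "adj U * U = 1\<^sub>m n" using assms(2) by (auto simp: unitary_def)
  \<comment> \<open>A zero column would put 0 on the diagonal of \<open>adj U * U\<close>.\<close>
  have "\<exists>k<n. U $$ (k, i) \<noteq> 0"
  proof (rule ccontr)
    assume "\<not> ?thesis"
    then have "(adj U * U) $$ (i, i) = 0"
      using U(1) assms(4) by (subst index_mult_sum[of _ n n _ n]) auto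
    then show False using U(2) assms(4) by simp
  qed
  moreover have "\<forall>v. (\<exists>i<n. v i \<noteq> 0) \<longrightarrow> 0 < Re (qform n A v)"
    using assms(1) by (simp add: pos_def_def)
  ultimately have "0 < Re (qform n A (\<lambda>k. U $$ (k, i)))"
    by (elim allE[where x = "\<lambda>k. U $$ (k, i)"] mp)
  then show ?thesis using qform_column[OF assms(2-4)] by simp
qed

text \<open>Cyclicity brings \<open>adj W\<close> to the front and leaves the overlap matrix
  \<open>M = adj W * U\<close> and its adjoint between the two diagonal matrices.\<close>

lemma mtrace_two_spectral:
  assumes U: "unitary n U" and W: "unitary n W"
  shows "mtrace ((U * diag_real n p * adj U) * (W * diag_real n g * adj W))
       = complex_of_real (\<Sum>j<n. \<Sum>i<n. (cmod ((adj W * U) $$ (j, i)))\<^sup>2 * p i * g j)"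
proof -
  define M where "M = adj W * U"
  have c: "U \<in> carrier_mat n n" "W \<in> carrier_mat n n" "adj U \<in> carrier_mat n n" "adj W \<in> carrier_mat n n"
    and M: "M \<in> carrier_mat n n" "adj M \<in> carrier_mat n n" "adj M = adj U * W"
    using U W by (auto simp: unitary_def M_def adj_mult[of _ n n _ n])
  have "mtrace ((U * diag_real n p * adj U) * (W * diag_real n g * adj W))
      = mtrace ((U * diag_real n p * adj U * W * diag_real n g) * adj W)"
    using c by (simp add: assoc_mult_mat[of _ n n _ n _ n])
  also have "\<dots> = mtrace (adj W * (U * diag_real n p * adj U * W * diag_real n g))"
    using c by (intro mtrace_cyclic[of _ n n]) auto
  also have "\<dots> = mtrace ((M * diag_real n p) * (adj M * diag_real n g))"
    using c unfolding M(3) unfolding M_def by (simp add: assoc_mult_mat[of _ n n _ n _ n])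
  also have "\<dots> = (\<Sum>j<n. \<Sum>i<n. (M $$ (j, i) * p i) * (cnj (M $$ (j, i)) * g j))"
    using M(1,2) by (subst mtrace_mult[of _ n n])
      (auto simp del: index_mult_mat(1) simp: index_mult_diag_real[of _ n] intro!: sum.cong)
  also have "\<dots> = complex_of_real (\<Sum>j<n. \<Sum>i<n. (cmod (M $$ (j, i)))\<^sup>2 * p i * g j)"
    by (auto simp: complex_norm_square simp del: of_real_power intro!: sum.cong)
  finally show ?thesis unfolding M_def .
qed

text \<open>The second basis \<open>W\<close> enters on purpose: it writes the trace with the same
  weights and index pairs as the cross terms, so that the sums can be combined. The proof takes the
  second operator to be the identity.\<close>

lemma mtrace_one_spectral:
  assumes U: "unitary n U" and W: "unitary n W"
  shows "mtrace (U * diag_real n p * adj U)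
       = complex_of_real (\<Sum>j<n. \<Sum>i<n. (cmod ((adj W * U) $$ (j, i)))\<^sup>2 * p i)"
proof -
  have "diag_real n (\<lambda>_. 1) = 1\<^sub>m n" by (rule eq_matI) auto
  then have "W * diag_real n (\<lambda>_. 1) * adj W = 1\<^sub>m n" using W by (auto simp: unitary_def)
  then show ?thesis using mtrace_two_spectral[OF U W, of p "\<lambda>_. 1"] U
    by (simp add: unitary_def right_mult_one_mat[of _ n n])
qed

subsection \<open>A variational formula for the resolvent\<close>

definition var_fun :: "nat \<Rightarrow> real \<Rightarrow> complex mat \<Rightarrow> complex mat \<Rightarrow> complex mat \<Rightarrow> real" where
  "var_fun n t \<eta> \<rho> X = 2 * Re (mtrace (adj X * \<eta>)) - Re (mtrace (X * adj X * \<rho>))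
     - t * Re (mtrace (adj X * X * \<eta>))"

text \<open>With rows of \<open>Z\<close> in the eigenbasis of \<rho> and columns in that of \<eta>,
  both quadratic terms become weighted sums of \<open>(cmod (Z $$ (j, i)))\<^sup>2\<close>. The
  entries decouple, and each can be optimised separately.\<close>

lemma var_fun_spectral:
  assumes U: "unitary n U" and W: "unitary n W" and Z: "Z \<in> carrier_mat n n"
  shows "var_fun n t (U * diag_real n p * adj U) (W * diag_real n q * adj W) (W * Z * adj U)
       = (\<Sum>j<n. \<Sum>i<n. 2 * Re (cnj (Z $$ (j, i)) * (adj W * U) $$ (j, i)) * p i
                        - (q j + t * p i) * (cmod (Z $$ (j, i)))\<^sup>2)"
proof -
  define M where "M = adj W * U"
  have c: "U \<in> carrier_mat n n" "W \<in> carrier_mat n n" "adj U \<in> carrier_mat n n" "adj W \<in> carrier_mat n n"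
    "Z \<in> carrier_mat n n" "adj Z \<in> carrier_mat n n" "M \<in> carrier_mat n n"
    using U W Z by (auto simp: unitary_def M_def)
  have adjX: "adj (W * Z * adj U) = U * (adj Z * adj W)"
    using c by (simp add: adj_mult[of _ n n _ n])
  note as = assoc_mult_mat[of _ n n _ n _ n]
  note uc = unitary_cancel[OF U, of _ n] unitary_cancel[OF W, of _ n]
  have conj_tr: "mtrace (V * (B * adj V)) = mtrace B" if "unitary n V" "B \<in> carrier_mat n n" for V B
  proof -
    have "mtrace (V * (B * adj V)) = mtrace ((B * adj V) * V)"
      using that by (intro mtrace_cyclic[of _ n n]) (auto simp: unitary_def)
    also have "\<dots> = mtrace B" using that by (auto simp: unitary_def as)
    finally show ?thesis .
  qed
  have "mtrace (adj (W * Z * adj U) * (U * diag_real n p * adj U))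
      = mtrace (U * ((adj Z * (M * diag_real n p)) * adj U))"
    unfolding adjX M_def using c by (simp add: as)
  also have "\<dots> = mtrace (adj Z * (M * diag_real n p))"
    using c by (intro conj_tr[OF U]) auto
  also have "\<dots> = (\<Sum>j<n. \<Sum>i<n. cnj (Z $$ (j, i)) * M $$ (j, i) * p i)"
    using c by (subst mtrace_mult[of _ n n], simp, simp, subst sum.swap)
      (auto simp del: index_mult_mat(1) simp: index_mult_diag_real[of _ n] intro!: sum.cong)
  finally have 1: "mtrace (adj (W * Z * adj U) * (U * diag_real n p * adj U))
      = (\<Sum>j<n. \<Sum>i<n. cnj (Z $$ (j, i)) * M $$ (j, i) * p i)" .
  have "mtrace ((W * Z * adj U) * adj (W * Z * adj U) * (W * diag_real n q * adj W))
      = mtrace (W * ((Z * (adj Z * diag_real n q)) * adj W))"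
    unfolding adjX using c by (simp add: as uc)
  also have "\<dots> = mtrace (Z * (adj Z * diag_real n q))"
    using c by (intro conj_tr[OF W]) auto
  also have "\<dots> = (\<Sum>j<n. \<Sum>i<n. complex_of_real (q j * (cmod (Z $$ (j, i)))\<^sup>2))"
    using c by (subst mtrace_mult[of _ n n], simp, simp)
      (auto simp del: index_mult_mat(1) of_real_power simp: index_mult_diag_real[of _ n] complex_norm_square intro!: sum.cong)
  finally have 2: "mtrace ((W * Z * adj U) * adj (W * Z * adj U) * (W * diag_real n q * adj W))
      = (\<Sum>j<n. \<Sum>i<n. complex_of_real (q j * (cmod (Z $$ (j, i)))\<^sup>2))" .
  have "mtrace (adj (W * Z * adj U) * (W * Z * adj U) * (U * diag_real n p * adj U))
      = mtrace (U * ((adj Z * (Z * diag_real n p)) * adj U))"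
    unfolding adjX using c by (simp add: as uc)
  also have "\<dots> = mtrace (adj Z * (Z * diag_real n p))"
    using c by (intro conj_tr[OF U]) auto
  also have "\<dots> = (\<Sum>j<n. \<Sum>i<n. complex_of_real (p i * (cmod (Z $$ (j, i)))\<^sup>2))"
    using c by (subst mtrace_mult[of _ n n], simp, simp, subst sum.swap)
      (auto simp del: index_mult_mat(1) of_real_power simp: index_mult_diag_real[of _ n] complex_norm_square intro!: sum.cong)
  finally have 3: "mtrace (adj (W * Z * adj U) * (W * Z * adj U) * (U * diag_real n p * adj U))
      = (\<Sum>j<n. \<Sum>i<n. complex_of_real (p i * (cmod (Z $$ (j, i)))\<^sup>2))" .
  have re: "Re (x * complex_of_real y) = Re x * y" for x y by simp
  show ?thesis
    unfolding var_fun_def 1 2 3 M_def[symmetric] Re_sum re Re_complex_of_real sum_distrib_left sum_subtractf[symmetric]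
    by (intro sum.cong refl) (simp add: algebra_simps)
qed

text \<open>\<open>s\<close> times the gap between the two sides is the squared modulus of
  \<open>s * z - p * m\<close>.\<close>

lemma complete_square_bound:
  fixes z m :: complex and p s :: real
  assumes "0 < s"
  shows "2 * Re (cnj z * m) * p - s * (cmod z)\<^sup>2 \<le> (cmod m)\<^sup>2 * p\<^sup>2 / s"
proof -
  have "0 \<le> (s * Re z - p * Re m)\<^sup>2 + (s * Im z - p * Im m)\<^sup>2" by simp
  also have "\<dots> = (cmod m)\<^sup>2 * p\<^sup>2 - s * (2 * Re (cnj z * m) * p - s * (cmod z)\<^sup>2)"
    unfolding cmod_power2 by (simp add: power2_eq_square algebra_simps)
  finally show ?thesis using assms by (simp add: field_simps)
qed

text \<open>This \<open>z\<close> is the point at which the square in the preceding bound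
  vanishes.\<close>

lemma complete_square_attained:
  fixes m :: complex and p s :: real
  assumes "0 < s"
  defines "z \<equiv> m * complex_of_real (p / s)"
  shows "2 * Re (cnj z * m) * p - s * (cmod z)\<^sup>2 = (cmod m)\<^sup>2 * p\<^sup>2 / s"
proof -
  have re: "Re (cnj z * m) = (cmod m)\<^sup>2 * (p / s)"
    unfolding z_def cmod_power2 by (simp add: power2_eq_square algebra_simps add_divide_distrib)
  have sq: "(cmod z)\<^sup>2 = (cmod m)\<^sup>2 * (p / s)\<^sup>2"
    unfolding z_def by (simp only: norm_mult norm_of_real power_mult_distrib power2_abs)
  show ?thesis unfolding re sq using assms(1) by (simp add: power2_eq_square field_simps)
qed

text \<open>Here w, p, q are indexed by pairs (j, i): q depends on j only, p on i only, and w is the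
  squared modulus of the overlap of the j-th eigenvector of \<open>\<rho>\<close> with the i-th of \<open>\<eta>\<close>.\<close>
lemma umegaki_variational:
  assumes \<eta>: "pos_semidef n \<eta>" and \<rho>: "pos_def n \<rho>"
  obtains w p q :: "nat \<times> nat \<Rightarrow> real" where
    "\<And>x. x \<in> {..<n} \<times> {..<n} \<Longrightarrow> 0 \<le> p x" "\<And>x. x \<in> {..<n} \<times> {..<n} \<Longrightarrow> 0 < q x"
    "umegaki n \<eta> \<rho> = (\<Sum>x\<in>{..<n} \<times> {..<n}. w x * p x * (ln (p x) - ln (q x)))"
    "Re (mtrace \<eta>) = (\<Sum>x\<in>{..<n} \<times> {..<n}. w x * p x)"
    "\<And>t X. 0 \<le> t \<Longrightarrow> X \<in> carrier_mat n n \<Longrightarrow>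
       var_fun n t \<eta> \<rho> X \<le> (\<Sum>x\<in>{..<n} \<times> {..<n}. w x * (p x)\<^sup>2 / (q x + t * p x))"
    "\<And>t. 0 \<le> t \<Longrightarrow> \<exists>X \<in> carrier_mat n n.
       var_fun n t \<eta> \<rho> X = (\<Sum>x\<in>{..<n} \<times> {..<n}. w x * (p x)\<^sup>2 / (q x + t * p x))"
proof -
  have h: "hermitian n \<eta>" "hermitian n \<rho>" using \<eta> \<rho> by (auto simp: pos_semidef_def pos_def_def)
  obtain U p where U: "unitary n U" and eU: "\<eta> = U * diag_real n p * adj U"
    and lU: "mlog n \<eta> = U * diag_real n (ln \<circ> p) * adj U"
    using mat_fun_spectral[OF h(1)] unfolding mlog_def by blast
  obtain W q where W: "unitary n W" and eW: "\<rho> = W * diag_real n q * adj W"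
    and lW: "mlog n \<rho> = W * diag_real n (ln \<circ> q) * adj W"
    using mat_fun_spectral[OF h(2)] unfolding mlog_def by blast
  have p: "0 \<le> p i" if "i < n" for i using pos_semidef_eigenvalue[OF \<eta> U eU that] .
  have q: "0 < q i" if "i < n" for i using pos_def_eigenvalue[OF \<rho> W eW that] .
  define M where "M = adj W * U"
  have c: "U \<in> carrier_mat n n" "W \<in> carrier_mat n n" "adj U \<in> carrier_mat n n" "adj W \<in> carrier_mat n n"
    using U W by (auto simp: unitary_def)
  let ?w = "\<lambda>x. (cmod (M $$ (fst x, snd x)))\<^sup>2" and ?p = "\<lambda>x. p (snd x)" and ?q = "\<lambda>x. q (fst x)"
  have prod: "(\<Sum>j<n. \<Sum>i<n. f j i) = (\<Sum>x\<in>{..<n} \<times> {..<n}. f (fst x) (snd x))" for f :: "nat \<Rightarrow> nat \<Rightarrow> real"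
    by (simp add: sum.cartesian_product case_prod_beta)
  have "\<eta> * mlog n \<eta> = U * diag_real n (\<lambda>i. p i * ln (p i)) * adj U"
  proof -
    have "\<eta> * mlog n \<eta> = U * ((diag_real n p * diag_real n (ln \<circ> p)) * adj U)"
      unfolding lU unfolding eU using c by (simp add: assoc_mult_mat[of _ n n _ n _ n] unitary_cancel[OF U, of _ n])
    then show ?thesis using c by (simp add: diag_real_mult assoc_mult_mat[of _ n n _ n _ n])
  qed
  then have 1: "Re (mtrace (\<eta> * mlog n \<eta>)) = (\<Sum>x\<in>{..<n} \<times> {..<n}. ?w x * (?p x * ln (?p x)))"
    using mtrace_one_spectral[OF U W] by (simp add: M_def prod)
  have 2: "Re (mtrace (\<eta> * mlog n \<rho>)) = (\<Sum>x\<in>{..<n} \<times> {..<n}. ?w x * ?p x * ln (?q x))"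
    unfolding lW eU mtrace_two_spectral[OF U W] Re_complex_of_real prod by (simp add: M_def)
  \<comment> \<open>Definiteness of \<rho> keeps all denominators positive, including at
    \<open>t = 0\<close> and for vanishing \<open>p i\<close>.\<close>
  have pos: "0 < q j + t * p i" if "0 \<le> t" "i < n" "j < n" for t i j
    using that p q by (simp add: add_pos_nonneg)
  have R: "(\<Sum>x\<in>{..<n} \<times> {..<n}. ?w x * (?p x)\<^sup>2 / (?q x + t * ?p x))
      = (\<Sum>j<n. \<Sum>i<n. (cmod (M $$ (j, i)))\<^sup>2 * (p i)\<^sup>2 / (q j + t * p i))" for t
    by (simp add: prod)
  show ?thesis
  proof (rule that[of ?p ?q ?w])
    show "umegaki n \<eta> \<rho> = (\<Sum>x\<in>{..<n} \<times> {..<n}. ?w x * ?p x * (ln (?p x) - ln (?q x)))"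
      unfolding umegaki_def 1 2 sum_subtractf[symmetric] by (simp add: algebra_simps)
    show "Re (mtrace \<eta>) = (\<Sum>x\<in>{..<n} \<times> {..<n}. ?w x * ?p x)"
      unfolding eU mtrace_one_spectral[OF U W] Re_complex_of_real prod M_def ..
    show "var_fun n t \<eta> \<rho> X \<le> (\<Sum>x\<in>{..<n} \<times> {..<n}. ?w x * (?p x)\<^sup>2 / (?q x + t * ?p x))"
      if t: "0 \<le> t" and X: "X \<in> carrier_mat n n" for t X
    proof -
      \<comment> \<open>The coordinates of \<open>X\<close> in the two eigenbases; the bound then
        holds entry by entry.\<close>
      define Z where "Z = adj W * X * U"
      have Z: "Z \<in> carrier_mat n n" and "X = W * Z * adj U"
        using c X U unfolding Z_def
        by (auto simp: assoc_mult_mat[of _ n n _ n _ n] unitary_cancel[OF W, of _ n])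
           (simp add: unitary_def)
      then show ?thesis
        unfolding R unfolding eU eW \<open>X = _\<close> var_fun_spectral[OF U W Z] M_def
        by (intro sum_mono complete_square_bound pos t) auto
    qed
    show "\<exists>X \<in> carrier_mat n n.
       var_fun n t \<eta> \<rho> X = (\<Sum>x\<in>{..<n} \<times> {..<n}. ?w x * (?p x)\<^sup>2 / (?q x + t * ?p x))"
      if t: "0 \<le> t" for t
    proof -
      \<comment> \<open>The entrywise maximiser from \<open>complete_square_attained\<close> with
        \<open>s = q j + t * p i\<close>.\<close>
      define Z where "Z = mat n n (\<lambda>(j, i). M $$ (j, i) * complex_of_real (p i / (q j + t * p i)))"
      have Z: "Z \<in> carrier_mat n n" by (simp add: Z_def)
      have "var_fun n t \<eta> \<rho> (W * Z * adj U)
          = (\<Sum>j<n. \<Sum>i<n. (cmod (M $$ (j, i)))\<^sup>2 * (p i)\<^sup>2 / (q j + t * p i))"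
        unfolding eU eW var_fun_spectral[OF U W Z] M_def[symmetric]
      proof (intro sum.cong refl)
        fix j i assume "j \<in> {..<n}" "i \<in> {..<n}"
        then show "2 * Re (cnj (Z $$ (j, i)) * M $$ (j, i)) * p i - (q j + t * p i) * (cmod (Z $$ (j, i)))\<^sup>2
            = (cmod (M $$ (j, i)))\<^sup>2 * (p i)\<^sup>2 / (q j + t * p i)"
          using complete_square_attained[OF pos[OF t, of i j], of "M $$ (j, i)" "p i"]
          by (simp add: Z_def)
      qed
      moreover have "W * Z * adj U \<in> carrier_mat n n" using c Z by simp
      ultimately show ?thesis unfolding R by (rule bexI)
    qed
  qed (auto simp: p q)
qed

subsection \<open>From resolvents to logarithms\<close>

text \<open>For \<open>p = 0\<close> the logarithm of \<open>q / T\<close> diverges, but the factor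
  \<open>p\<close> makes the function constantly 0. For \<open>p > 0\<close> this is continuity of
  \<open>ln\<close> at \<open>p\<close>.\<close>

lemma tendsto_mult_ln_diff:
  fixes p q :: real
  assumes "0 \<le> p" "0 < q"
  shows "((\<lambda>T. p * (ln (q / T + p) - ln q)) \<longlongrightarrow> p * (ln p - ln q)) at_top"
proof (cases "p = 0")
  case False
  have "((\<lambda>T. q / T) \<longlongrightarrow> 0) at_top"
    by (rule tendsto_divide_0[OF tendsto_const filterlim_at_top_imp_at_infinity[OF filterlim_ident]])
  then have "((\<lambda>T. q / T + p) \<longlongrightarrow> p) at_top"
    using tendsto_add[of "\<lambda>T. q / T" 0 at_top "\<lambda>_. p" p] by simp
  then show ?thesis using False assms by (auto intro!: tendsto_intros)
qed simp

text \<open>The functions g and k of the proof are one primitive in T of the difference of the resolvent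
  sums; equality of the masses cancels the divergent term \<open>ln T\<close>, and the limit at infinity is the
  difference of the relative entropies.\<close>
lemma relative_entropy_le_of_resolvent_le:
  fixes w p q :: "'a \<Rightarrow> real" and w' p' q' :: "'b \<Rightarrow> real"
  assumes pos: "\<And>x. x \<in> I \<Longrightarrow> 0 \<le> p x" "\<And>x. x \<in> I \<Longrightarrow> 0 < q x"
    and pos': "\<And>y. y \<in> J \<Longrightarrow> 0 \<le> p' y" "\<And>y. y \<in> J \<Longrightarrow> 0 < q' y"
    and mass: "(\<Sum>y\<in>J. w' y * p' y) = (\<Sum>x\<in>I. w x * p x)"
    and resolvent: "\<And>t. 0 \<le> t \<Longrightarrow> (\<Sum>y\<in>J. w' y * (p' y)\<^sup>2 / (q' y + t * p' y))
                     \<le> (\<Sum>x\<in>I. w x * (p x)\<^sup>2 / (q x + t * p x))"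
  shows "(\<Sum>y\<in>J. w' y * p' y * (ln (p' y) - ln (q' y)))
       \<le> (\<Sum>x\<in>I. w x * p x * (ln (p x) - ln (q x)))"
proof -
  define g where "g T = (\<Sum>x\<in>I. w x * p x * (ln (q x + T * p x) - ln (q x)))
                      - (\<Sum>y\<in>J. w' y * p' y * (ln (q' y + T * p' y) - ln (q' y)))" for T
  define k where "k T = (\<Sum>x\<in>I. w x * (p x * (ln (q x / T + p x) - ln (q x))))
                      - (\<Sum>y\<in>J. w' y * (p' y * (ln (q' y / T + p' y) - ln (q' y))))" for T
  have g_nonneg: "0 \<le> g T" if "0 \<le> T" for T
  proof -
    \<comment> \<open>\<open>g\<close> vanishes at 0, and its derivative at \<open>t\<close> is the
      difference of the two resolvent sums, nonnegative by assumption.\<close>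
    have "g 0 \<le> g T"
    proof (rule DERIV_nonneg_imp_nondecreasing[OF that])
      fix t assume t: "0 \<le> t" "t \<le> T"
      have "(g has_real_derivative (\<Sum>x\<in>I. w x * (p x)\<^sup>2 / (q x + t * p x))
          - (\<Sum>y\<in>J. w' y * (p' y)\<^sup>2 / (q' y + t * p' y))) (at t)"
        unfolding g_def[abs_def]
        by (rule DERIV_diff; rule DERIV_sum; rule derivative_eq_intros refl)+
           (use t in \<open>auto intro!: derivative_eq_intros simp: pos pos' add_pos_nonneg power2_eq_square\<close>)
      then show "\<exists>y. (g has_real_derivative y) (at t) \<and> 0 \<le> y" using resolvent[OF t(1)] by force
    qed
    then show ?thesis by (simp add: g_def)
  qed
  \<comment> \<open>Splitting off \<open>ln T\<close> isolates the divergent part of each logarithm;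
    its total coefficient in \<open>g\<close> is the difference of the masses.\<close>
  have lnT: "ln (b + T * a) = ln (b / T + a) + ln T" if "0 < T" "0 \<le> a" "0 < b" for a b T :: real
  proof -
    have "b + T * a = (b / T + a) * T" using that by (simp add: field_simps)
    moreover have "0 < b / T + a" using that by (simp add: add_pos_nonneg)
    ultimately show ?thesis using that by (simp add: ln_mult)
  qed
  have "g T = k T" if "0 < T" for T
  proof -
    have "g T = (\<Sum>x\<in>I. w x * (p x * (ln (q x / T + p x) - ln (q x))) + w x * p x * ln T)
              - (\<Sum>y\<in>J. w' y * (p' y * (ln (q' y / T + p' y) - ln (q' y))) + w' y * p' y * ln T)"
      unfolding g_def using that pos pos'
      by (intro arg_cong2[of _ _ _ _ "(-)"] sum.cong refl) (simp_all add: lnT algebra_simps)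
    also have "\<dots> = k T" unfolding k_def sum.distrib sum_distrib_right[symmetric] mass by simp
    finally show ?thesis .
  qed
  then have "eventually (\<lambda>T. 0 \<le> k T) at_top"
    using g_nonneg by (intro eventually_mono[OF eventually_gt_at_top[of 0]]) (metis less_imp_le)
  moreover have "(k \<longlongrightarrow> (\<Sum>x\<in>I. w x * (p x * (ln (p x) - ln (q x))))
      - (\<Sum>y\<in>J. w' y * (p' y * (ln (p' y) - ln (q' y))))) at_top"
    unfolding k_def[abs_def] by (intro tendsto_intros tendsto_mult_ln_diff pos pos')
  ultimately have "0 \<le> (\<Sum>x\<in>I. w x * (p x * (ln (p x) - ln (q x))))
      - (\<Sum>y\<in>J. w' y * (p' y * (ln (p' y) - ln (q' y))))"
    by (intro tendsto_lowerbound[of k _ at_top]) auto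
  then show ?thesis by (simp add: mult.assoc)
qed

subsection \<open>The partial trace\<close>

lemma sum_kronecker_index:
  fixes f :: "nat \<Rightarrow> 'a :: comm_monoid_add"
  shows "(\<Sum>i<m * k. f i) = (\<Sum>a<m. \<Sum>l<k. f (a * k + l))"
proof -
  have "(\<Sum>i<m * k. f i) = (\<Sum>a<m. sum f {a * k..<a * k + k})" by (simp add: sum.nat_group)
  also have "\<dots> = (\<Sum>a<m. \<Sum>l<k. f (a * k + l))"
    using sum.shift_bounds_nat_ivl[of f 0 "_ * k" k]
    by (auto simp: atLeast0LessThan add.commute intro!: sum.cong)
  finally show ?thesis .
qed

lemma kronecker_index_less:
  fixes a m l k :: nat
  assumes "a < m" "l < k"
  shows "a * k + l < m * k"
proof -
  have "a * k + l < Suc a * k" using assms by simp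
  also have "\<dots> \<le> m * k" using assms by (intro mult_le_mono1) simp
  finally show ?thesis .
qed

lemma ptrace_L_carrier [simp]: "ptrace_L dV dL A \<in> carrier_mat dV dV"
  by (simp add: ptrace_L_def)

lemma mtrace_ptrace_L:
  assumes "A \<in> carrier_mat (dV * dL) (dV * dL)"
  shows "mtrace (ptrace_L dV dL A) = mtrace A"
  using assms by (simp add: mtrace_def ptrace_L_def sum_kronecker_index)

lemma hermitian_ptrace_L:
  assumes "hermitian (dV * dL) A"
  shows "hermitian dV (ptrace_L dV dL A)"
proof -
  have sym: "A $$ (i, j) = cnj (A $$ (j, i))" if "i < dV * dL" "j < dV * dL" for i j
  proof -
    have "A \<in> carrier_mat (dV * dL) (dV * dL)" "adj A = A"
      using assms by (auto simp: hermitian_def)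
    then show ?thesis using that adj_index[of i A j] by simp
  qed
  show ?thesis unfolding hermitian_def
    by (auto simp: ptrace_L_def adj_def kronecker_index_less sym[symmetric] intro!: eq_matI)
qed

text \<open>The k-th test vector is \<open>v\<close> tensored with the k-th basis vector of the
  L-factor. Positivity of \<open>A\<close> thus passes to the partial trace summand by
  summand.\<close>

lemma qform_ptrace_L:
  "qform dV (ptrace_L dV dL A) v
    = (\<Sum>k<dL. qform (dV * dL) A (\<lambda>i. if i mod dL = k then v (i div dL) else 0))"
proof -
  have "qform (dV * dL) A (\<lambda>i. if i mod dL = k then v (i div dL) else 0)
      = (\<Sum>a<dV. \<Sum>b<dV. cnj (v a) * A $$ (a * dL + k, b * dL + k) * v b)" if k: "k < dL" for k
  proof -
    have "qform (dV * dL) A (\<lambda>i. if i mod dL = k then v (i div dL) else 0)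
      = (\<Sum>a<dV. \<Sum>l<dL. \<Sum>b<dV. \<Sum>l'<dL. if l' = k then (if l = k then cnj (v a) * A $$ (a * dL + l, b * dL + l') * v b else 0) else 0)"
      unfolding qform_def sum_kronecker_index by (intro sum.cong refl) auto
    also have "\<dots> = (\<Sum>a<dV. \<Sum>l<dL. if l = k then (\<Sum>b<dV. cnj (v a) * A $$ (a * dL + l, b * dL + k) * v b) else 0)"
      using k by (intro sum.cong refl) simp
    finally show ?thesis using k by simp
  qed
  then have "(\<Sum>k<dL. qform (dV * dL) A (\<lambda>i. if i mod dL = k then v (i div dL) else 0))
      = (\<Sum>k<dL. \<Sum>a<dV. \<Sum>b<dV. cnj (v a) * A $$ (a * dL + k, b * dL + k) * v b)" by simp
  also have "\<dots> = (\<Sum>a<dV. \<Sum>b<dV. \<Sum>k<dL. cnj (v a) * A $$ (a * dL + k, b * dL + k) * v b)"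
    by (subst sum.swap) (intro sum.cong refl sum.swap)
  also have "\<dots> = qform dV (ptrace_L dV dL A) v"
    by (simp add: qform_def ptrace_L_def sum_distrib_left sum_distrib_right)
  finally show ?thesis by simp
qed

lemma pos_semidef_ptrace_L:
  assumes "pos_semidef (dV * dL) A"
  shows "pos_semidef dV (ptrace_L dV dL A)"
  using assms by (auto simp: pos_semidef_def hermitian_ptrace_L qform_ptrace_L intro!: sum_nonneg)

text \<open>Every summand of \<open>qform_ptrace_L\<close> is strictly positive, and
  \<open>0 < dL\<close> makes the sum nonempty; for \<open>dL = 0\<close> the partial trace would be
  the zero matrix.\<close>

lemma pos_def_ptrace_L:
  assumes "pos_def (dV * dL) A" "0 < dL"
  shows "pos_def dV (ptrace_L dV dL A)"
  unfolding pos_def_def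
proof (intro conjI allI impI)
  show "hermitian dV (ptrace_L dV dL A)" using assms by (simp add: pos_def_def hermitian_ptrace_L)
  fix v :: "nat \<Rightarrow> complex" assume "\<exists>i<dV. v i \<noteq> 0"
  then obtain a where a: "a < dV" "v a \<noteq> 0" by blast
  have "0 < Re (qform (dV * dL) A (\<lambda>i. if i mod dL = k then v (i div dL) else 0))" if "k < dL" for k
    using assms(1) a that unfolding pos_def_def
    \<comment> \<open>The tensor vector is nonzero at index \<open>a * dL + k\<close>, where its
      value is \<open>v a\<close>.\<close>
    by (elim conjE allE impE) (auto intro!: exI[of _ "a * dL + k"] simp: kronecker_index_less)
  then show "0 < Re (qform dV (ptrace_L dV dL A) v)"
    using assms(2) by (auto simp: qform_ptrace_L intro!: sum_pos)
qed

text \<open>The operator \<open>Y \<otimes> I\<close>.\<close>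
definition ampliate :: "nat \<Rightarrow> nat \<Rightarrow> complex mat \<Rightarrow> complex mat" where
  "ampliate dV dL Y = mat (dV * dL) (dV * dL)
     (\<lambda>(i, j). if i mod dL = j mod dL then Y $$ (i div dL, j div dL) else 0)"

lemma ampliate_carrier [simp]: "ampliate dV dL Y \<in> carrier_mat (dV * dL) (dV * dL)"
  by (simp add: ampliate_def)

lemma div_less_kronecker: "i < m * k \<Longrightarrow> i div k < (m :: nat)"
  by (simp add: less_mult_imp_div_less)

lemma adj_ampliate:
  assumes "Y \<in> carrier_mat dV dV"
  shows "adj (ampliate dV dL Y) = ampliate dV dL (adj Y)"
  using assms by (intro eq_matI) (auto simp: ampliate_def adj_def div_less_kronecker)

lemma ampliate_mult:
  assumes "Y \<in> carrier_mat dV dV" "Z \<in> carrier_mat dV dV"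
  shows "ampliate dV dL Y * ampliate dV dL Z = ampliate dV dL (Y * Z)"
proof (rule eq_matI)
  fix i j assume "i < dim_row (ampliate dV dL (Y * Z))" "j < dim_col (ampliate dV dL (Y * Z))"
  then have ij: "i < dV * dL" "j < dV * dL" by (auto simp: ampliate_def)
  \<comment> \<open>The existence of an index \<open>i\<close> below \<open>dV * dL\<close> excludes
    \<open>dL = 0\<close>; hence \<open>i mod dL\<close> lies in the range of the inner sum.\<close>
  then have dL: "0 < dL" by (cases dL) auto
  have "(ampliate dV dL Y * ampliate dV dL Z) $$ (i, j)
      = (\<Sum>a<dV. \<Sum>l<dL. ampliate dV dL Y $$ (i, a * dL + l) * ampliate dV dL Z $$ (a * dL + l, j))"
    unfolding index_mult_sum[OF ampliate_carrier ampliate_carrier ij] by (rule sum_kronecker_index)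
  also have "\<dots> = (\<Sum>a<dV. \<Sum>l<dL. if l = i mod dL then
      (if i mod dL = j mod dL then Y $$ (i div dL, a) * Z $$ (a, j div dL) else 0) else 0)"
    using ij by (intro sum.cong refl) (auto simp: ampliate_def kronecker_index_less)
  also have "\<dots> = ampliate dV dL (Y * Z) $$ (i, j)"
    using ij assms dL by (auto simp: ampliate_def scalar_prod_def atLeast0LessThan div_less_kronecker)
  finally show "(ampliate dV dL Y * ampliate dV dL Z) $$ (i, j) = ampliate dV dL (Y * Z) $$ (i, j)" .
qed (auto simp: ampliate_def)

text \<open>Ampliation is dual to the partial trace under the trace pairing: the identity factor
  forces equal L-indices, and summing over them is the partial trace.\<close>

lemma mtrace_ampliate_mult:
  assumes Y: "Y \<in> carrier_mat dV dV" and A: "A \<in> carrier_mat (dV * dL) (dV * dL)"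
  shows "mtrace (ampliate dV dL Y * A) = mtrace (Y * ptrace_L dV dL A)"
proof -
  have "mtrace (ampliate dV dL Y * A) = (\<Sum>i<dV * dL. \<Sum>j<dV * dL. ampliate dV dL Y $$ (i, j) * A $$ (j, i))"
    using A by (auto simp: mtrace_def scalar_prod_def atLeast0LessThan ampliate_def)
  also have "\<dots> = (\<Sum>a<dV. \<Sum>l<dL. \<Sum>b<dV. \<Sum>k<dL. if k = l then Y $$ (a, b) * A $$ (b * dL + k, a * dL + l) else 0)"
    unfolding sum_kronecker_index
    by (intro sum.cong refl) (auto simp: ampliate_def kronecker_index_less)
  also have "\<dots> = (\<Sum>a<dV. \<Sum>l<dL. \<Sum>b<dV. Y $$ (a, b) * A $$ (b * dL + l, a * dL + l))"
    by (intro sum.cong refl) simp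
  also have "\<dots> = (\<Sum>a<dV. \<Sum>b<dV. \<Sum>l<dL. Y $$ (a, b) * A $$ (b * dL + l, a * dL + l))"
    by (rule sum.cong[OF refl], rule sum.swap)
  also have "\<dots> = mtrace (Y * ptrace_L dV dL A)"
    using Y by (auto simp: mtrace_def scalar_prod_def atLeast0LessThan ptrace_L_def sum_distrib_left)
  finally show ?thesis .
qed

subsection \<open>Monotonicity of the relative entropy\<close>

text \<open>Ampliation respects products and adjoints, so each of the three traces has the form
  treated by \<open>mtrace_ampliate_mult\<close>.\<close>

lemma var_fun_ampliate:
  assumes "Y \<in> carrier_mat dV dV" "\<eta> \<in> carrier_mat (dV * dL) (dV * dL)" "\<rho> \<in> carrier_mat (dV * dL) (dV * dL)"
  shows "var_fun (dV * dL) t \<eta> \<rho> (ampliate dV dL Y)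
       = var_fun dV t (ptrace_L dV dL \<eta>) (ptrace_L dV dL \<rho>) Y"
  using assms by (simp add: var_fun_def adj_ampliate ampliate_mult mtrace_ampliate_mult)

theorem umegaki_ptrace_L_le:
  assumes \<eta>: "pos_semidef (dV * dL) \<eta>" and \<rho>: "pos_def (dV * dL) \<rho>" and dL: "0 < dL"
  shows "umegaki dV (ptrace_L dV dL \<eta>) (ptrace_L dV dL \<rho>) \<le> umegaki (dV * dL) \<eta> \<rho>"
proof -
  let ?N = "dV * dL" and ?\<eta> = "ptrace_L dV dL \<eta>" and ?\<rho> = "ptrace_L dV dL \<rho>"
  have c: "\<eta> \<in> carrier_mat ?N ?N" "\<rho> \<in> carrier_mat ?N ?N"
    using \<eta> \<rho> by (auto simp: pos_semidef_def pos_def_def hermitian_def)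
  obtain w p q where V:
    "\<And>x. x \<in> {..<?N} \<times> {..<?N} \<Longrightarrow> 0 \<le> p x" "\<And>x. x \<in> {..<?N} \<times> {..<?N} \<Longrightarrow> 0 < q x"
    "umegaki ?N \<eta> \<rho> = (\<Sum>x\<in>{..<?N} \<times> {..<?N}. w x * p x * (ln (p x) - ln (q x)))"
    "Re (mtrace \<eta>) = (\<Sum>x\<in>{..<?N} \<times> {..<?N}. w x * p x)"
    "\<And>t X. 0 \<le> t \<Longrightarrow> X \<in> carrier_mat ?N ?N \<Longrightarrow>
       var_fun ?N t \<eta> \<rho> X \<le> (\<Sum>x\<in>{..<?N} \<times> {..<?N}. w x * (p x)\<^sup>2 / (q x + t * p x))"
    "\<And>t. 0 \<le> t \<Longrightarrow> \<exists>X \<in> carrier_mat ?N ?N.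
       var_fun ?N t \<eta> \<rho> X = (\<Sum>x\<in>{..<?N} \<times> {..<?N}. w x * (p x)\<^sup>2 / (q x + t * p x))"
    by (rule umegaki_variational[OF \<eta> \<rho>]) (rule that, assumption+)
  obtain w' p' q' where V':
    "\<And>x. x \<in> {..<dV} \<times> {..<dV} \<Longrightarrow> 0 \<le> p' x" "\<And>x. x \<in> {..<dV} \<times> {..<dV} \<Longrightarrow> 0 < q' x"
    "umegaki dV ?\<eta> ?\<rho> = (\<Sum>x\<in>{..<dV} \<times> {..<dV}. w' x * p' x * (ln (p' x) - ln (q' x)))"
    "Re (mtrace ?\<eta>) = (\<Sum>x\<in>{..<dV} \<times> {..<dV}. w' x * p' x)"
    "\<And>t X. 0 \<le> t \<Longrightarrow> X \<in> carrier_mat dV dV \<Longrightarrow>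
       var_fun dV t ?\<eta> ?\<rho> X \<le> (\<Sum>x\<in>{..<dV} \<times> {..<dV}. w' x * (p' x)\<^sup>2 / (q' x + t * p' x))"
    "\<And>t. 0 \<le> t \<Longrightarrow> \<exists>X \<in> carrier_mat dV dV.
       var_fun dV t ?\<eta> ?\<rho> X = (\<Sum>x\<in>{..<dV} \<times> {..<dV}. w' x * (p' x)\<^sup>2 / (q' x + t * p' x))"
    by (rule umegaki_variational[OF pos_semidef_ptrace_L[OF \<eta>] pos_def_ptrace_L[OF \<rho> dL]])
       (rule that, assumption+)
  show ?thesis
    unfolding V(3) V'(3)
  proof (rule relative_entropy_le_of_resolvent_le[OF V(1,2) V'(1,2)])
    show "(\<Sum>x\<in>{..<dV} \<times> {..<dV}. w' x * p' x) = (\<Sum>x\<in>{..<?N} \<times> {..<?N}. w x * p x)"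
      unfolding V(4)[symmetric] V'(4)[symmetric] mtrace_ptrace_L[OF c(1)] ..
  next
    \<comment> \<open>The optimal \<open>Y\<close> for the partial traces yields the competitor
      \<open>ampliate dV dL Y\<close> in the larger problem, with the same value.\<close>
    fix t :: real assume t: "0 \<le> t"
    then obtain Y where Y: "Y \<in> carrier_mat dV dV"
      "var_fun dV t ?\<eta> ?\<rho> Y = (\<Sum>x\<in>{..<dV} \<times> {..<dV}. w' x * (p' x)\<^sup>2 / (q' x + t * p' x))"
      using V'(6) by blast
    then show "(\<Sum>x\<in>{..<dV} \<times> {..<dV}. w' x * (p' x)\<^sup>2 / (q' x + t * p' x))
        \<le> (\<Sum>x\<in>{..<?N} \<times> {..<?N}. w x * (p x)\<^sup>2 / (q x + t * p x))"
      using V(5)[OF t ampliate_carrier, of Y] var_fun_ampliate[OF Y(1) c, of t] by simp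
  qed
qed

section \<open>The minorant property and the ascent step\<close>

theorem mainTheorem4:
  fixes dV dL :: nat and \<eta>V \<eta>t :: "complex mat" and \<rho> :: "'p \<Rightarrow> complex mat" and \<theta>t :: 'p
  assumes target: "density dV \<eta>V"
    and model: "\<And>\<theta>. density (dV * dL) (\<rho> \<theta>) \<and> pos_def (dV * dL) (\<rho> \<theta>)"
    and eta_feas: "density (dV * dL) \<eta>t" "ptrace_L dV dL \<eta>t = \<eta>V"
    and eta_min: "\<And>\<eta>. density (dV * dL) \<eta> \<Longrightarrow> ptrace_L dV dL \<eta> = \<eta>V \<Longrightarrow>
                    umegaki (dV * dL) \<eta>t (\<rho> \<theta>t) \<le> umegaki (dV * dL) \<eta> (\<rho> \<theta>t)"
    and equality: "umegaki (dV * dL) \<eta>t (\<rho> \<theta>t) = umegaki dV \<eta>V (ptrace_L dV dL (\<rho> \<theta>t))"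
  shows "(\<forall>\<theta>. loglik dV dL \<eta>V \<rho> \<theta> \<ge> Qfun dV dL \<eta>V \<eta>t \<rho> \<theta>)
       \<and> loglik dV dL \<eta>V \<rho> \<theta>t = Qfun dV dL \<eta>V \<eta>t \<rho> \<theta>t
       \<and> (\<forall>\<theta>'. (\<forall>\<theta>. Qfun dV dL \<eta>V \<eta>t \<rho> \<theta> \<le> Qfun dV dL \<eta>V \<eta>t \<rho> \<theta>')
               \<longrightarrow> loglik dV dL \<eta>V \<rho> \<theta>' \<ge> loglik dV dL \<eta>V \<rho> \<theta>t)"
proof -
  \<comment> \<open>For \<open>dL = 0\<close> the product space is zero, and no operator on it has
    trace 1.\<close>
  have dL: "0 < dL"
  proof (rule ccontr)
    assume "\<not> 0 < dL"
    moreover have "\<eta>t \<in> carrier_mat (dV * dL) (dV * dL)"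
      using eta_feas(1) by (simp add: density_def pos_semidef_def hermitian_def)
    ultimately have "mtrace \<eta>t = 0" by (simp add: mtrace_def)
    then show False using eta_feas(1) by (simp add: density_def)
  qed
  \<comment> \<open>The two entropy terms of \<open>Qfun\<close> supply exactly the self-terms of
    the two relative entropies.\<close>
  have gap: "loglik dV dL \<eta>V \<rho> \<theta> - Qfun dV dL \<eta>V \<eta>t \<rho> \<theta>
      = umegaki (dV * dL) \<eta>t (\<rho> \<theta>) - umegaki dV \<eta>V (ptrace_L dV dL (\<rho> \<theta>))" for \<theta>
    by (simp add: loglik_def Qfun_def umegaki_def vn_entropy_def)
  have minorant: "Qfun dV dL \<eta>V \<eta>t \<rho> \<theta> \<le> loglik dV dL \<eta>V \<rho> \<theta>" for \<theta>
    using umegaki_ptrace_L_le[of dV dL \<eta>t "\<rho> \<theta>"] eta_feas model[of \<theta>] dL gap[of \<theta>]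
    by (simp add: density_def)
  have touch: "loglik dV dL \<eta>V \<rho> \<theta>t = Qfun dV dL \<eta>V \<eta>t \<rho> \<theta>t"
    using gap[of \<theta>t] equality by simp
  have "loglik dV dL \<eta>V \<rho> \<theta>t \<le> loglik dV dL \<eta>V \<rho> \<theta>'"
    if "\<forall>\<theta>. Qfun dV dL \<eta>V \<eta>t \<rho> \<theta> \<le> Qfun dV dL \<eta>V \<eta>t \<rho> \<theta>'" for \<theta>'
    \<comment> \<open>The chain is: log-likelihood at \<theta>t equals \<open>Qfun\<close> at
      \<theta>t, at most \<open>Qfun\<close> at the maximiser, at most the log-likelihood
      there.\<close>
    unfolding touch using that[rule_format, of \<theta>t] minorant[of \<theta>'] by (rule order_trans)
  then show ?thesis using minorant touch by blast
qed

end
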